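(* Let $n\ge 0$ be an integer and let $a_0,a_1,\ldots,a_n$ be real numbers with $a_0\ge a_k>0$ for $k=1,2,\ldots,n$ and $a_0>0$. If $(n+1)a_0<2\pi$, then $$\sum_{m=0}^{\infty}\prod_{k=0}^{n}\operatorname{sinc}(a_k m)\ \ge\ \sum_{m=0}^{\infty}\operatorname{sinc}^{n+1}(a_0 m).$$
   Context: Here $\operatorname{sinc}(t)=\frac{\sin t}{t}$ for $t\neq 0$ and $\operatorname{sinc}(0)=1$; $\operatorname{sinc}^{n+1}(x)$ denotes $(\operatorname{sinc}(x))^{n+1}$. Infinite series are limits of their partial sums. *)

theory Defs
  imports "HOL-Probability.Sinc_Integral"
begin

end

theory Submission
  imports Defs
begin

text \<open>
  The coefficients \<open>c m = \<Prod> sinc (a\<^sub>k m)\<close> are the cosine coefficients of a distribution on the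
  circle, namely of the convolution of the uniform distributions on the arcs \<open>[-a\<^sub>k, a\<^sub>k]\<close>.
  Convolving a symmetric density that decreases from \<open>0\<close> to \<open>pi\<close> with the uniform distribution on
  a symmetric arc keeps it symmetric and decreasing. The sum over \<open>m\<close> is essentially the value at \<open>0\<close>
  of the density of the whole convolution: if the density before the convolution with the \<open>k\<close>-th arc is called \<open>h\<close>, this
  value is the mean of \<open>h\<close> over \<open>[0, a\<^sub>k]\<close>. The mean of a decreasing function does not go up when
  the interval grows. Hence enlarging any one of the \<open>a\<^sub>k\<close> to \<open>a\<^sub>0\<close> cannot raise the sum, and enlarging
  them one after the other gives the theorem.

  All of this is done with series instead of measures. A coefficient sequence \<open>c\<close> is called
  \<open>cos_unimodal\<close> if its cosine series converges absolutely and decreases on \<open>[0, pi]\<close>.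
  Multiplication by \<open>sinc (a m)\<close> is convolution with an arc, and it preserves this property
  (\<open>cos_unimodal_mult_sinc\<close>); the monotonicity of means is \<open>suminf_sinc_antimono\<close>.
  The process would have to start from the point mass at \<open>0\<close>, whose cosine series diverges, so it
  starts from the Poisson kernel (up to affine normalization) instead, with coefficients \<open>r ^ m\<close> and \<open>r < 1\<close>
  (\<open>cos_unimodal_geometric\<close>). The inequality then holds with every term weighted by
  \<open>r ^ m\<close>, and \<open>r \<longlonglongrightarrow> 1\<close> gives the result as soon as there are two factors, which make the
  series absolutely convergent. Two factors also make \<open>a\<^sub>0 \<le> pi\<close>, so that all the arcs
  fit on the circle. With a single factor the two sides coincide, and only the conditional
  convergence of the series has to be shown.
\<close>

section \<open>The sinc function\<close>

text \<open>A constant for the conditional expression that \<open>sinc\<close> abbreviates, so that simplification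
  does not split it.\<close>

definition sinc_of :: "real \<Rightarrow> real" where
  "sinc_of x = sinc x"

text \<open>As a function of \<open>x\<close>, this is the antiderivative of \<open>cos (x * y)\<close> that vanishes at \<open>0\<close>, also
  for \<open>y = 0\<close>; the zeroth term of the series below therefore needs no separate treatment.\<close>

lemma mult_sinc_of_scaled: "x * sinc_of (x * y) = (if y = 0 then x else sin (x * y) / y)"
  by (auto simp: sinc_of_def)

lemma abs_sinc_of_le_1: "\<bar>sinc_of x\<bar> \<le> 1"
  using abs_sin_x_le_abs_x[of x] by (auto simp: sinc_of_def divide_simps)

lemma abs_sinc_of_le: "x > 0 \<Longrightarrow> \<bar>sinc_of x\<bar> \<le> 1 / x"
  by (auto simp: sinc_of_def divide_simps)

section \<open>Unimodal cosine series\<close>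

definition cos_series :: "(nat \<Rightarrow> real) \<Rightarrow> real \<Rightarrow> real" where
  "cos_series c t = (\<Sum>m. c m * cos (t * real m))"

definition cos_unimodal :: "(nat \<Rightarrow> real) \<Rightarrow> bool" where
  "cos_unimodal c \<longleftrightarrow> summable (\<lambda>m. \<bar>c m\<bar>) \<and> antimono_on {0..pi} (cos_series c)"

lemma cos_unimodalD:
  assumes "cos_unimodal c"
  shows "summable (\<lambda>m. \<bar>c m\<bar>)"
    and "0 \<le> s \<Longrightarrow> s \<le> t \<Longrightarrow> t \<le> pi \<Longrightarrow> cos_series c t \<le> cos_series c s"
  using assms by (auto simp: cos_unimodal_def monotone_on_def)

text \<open>A cosine series is symmetric about \<open>0\<close> and about \<open>pi\<close>. These symmetries carry the
  monotonicity from \<open>[0, pi]\<close> to the whole circle.\<close>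

lemma cos_series_neg: "cos_series c (- t) = cos_series c t"
  by (simp add: cos_series_def)

lemma cos_series_reflect: "cos_series c (2 * pi - t) = cos_series c t"
proof -
  have "cos ((2 * pi - t) * real m) = cos (t * real m)" for m
  proof -
    have "cos ((2 * pi - t) * real m) = cos (2 * pi * real m - t * real m)"
      by (simp add: algebra_simps)
    also have "\<dots> = cos (2 * pi * real m) * cos (t * real m) + sin (2 * pi * real m) * sin (t * real m)"
      by (rule cos_diff)
    also have "\<dots> = cos (t * real m)"
      using cos_int_2pin[of "int m"] sin_int_2pin[of "int m"] by simp
    finally show ?thesis .
  qed
  thus ?thesis by (simp add: cos_series_def)
qed

lemma summable_mult_bounded:
  fixes c d :: "nat \<Rightarrow> real"
  assumes "summable (\<lambda>m. \<bar>c m\<bar>)" and "\<And>m. \<bar>d m\<bar> \<le> B"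
  shows "summable (\<lambda>m. \<bar>c m * d m\<bar>)"
  by (rule summable_comparison_test'[OF summable_mult2[OF assms(1), of B], of 0])
     (auto simp: abs_mult intro!: mult_left_mono assms(2))

lemma has_derivative_sinc_series:
  assumes c: "summable (\<lambda>m. \<bar>c m\<bar>)"
  shows "((\<lambda>x. \<Sum>m. c m * (x * sinc_of (x * real m))) has_real_derivative cos_series c x) (at x)"
  unfolding cos_series_def
proof (rule has_field_derivative_series'(2)[where S = UNIV and ?x0.0 = 0])
  show "((\<lambda>x. c m * (x * sinc_of (x * real m))) has_real_derivative c m * cos (x * real m))
          (at x within UNIV)" for m x
    unfolding mult_sinc_of_scaled by (cases "m = 0") (auto intro!: derivative_eq_intros)
  show "uniformly_convergent_on UNIV (\<lambda>n x. \<Sum>m<n. c m * cos (x * real m))"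
  proof (rule Weierstrass_m_test'[OF _ c])
    show "norm (c m * cos (x * real m)) \<le> \<bar>c m\<bar>" for m x
      by (simp add: abs_mult mult_left_le)
  qed
qed auto

text \<open>With \<open>F\<close> the antiderivative of the cosine series that vanishes at \<open>0\<close>, the two sums are
  \<open>F b / b\<close> and \<open>F a / a\<close>, the means of the series over \<open>[0, b]\<close> and \<open>[0, a]\<close>. The value of the
  series at \<open>a\<close> separates the mean over \<open>[0, a]\<close> from the mean over \<open>[a, b]\<close>.\<close>

lemma suminf_sinc_antimono:
  assumes c: "cos_unimodal c" and ab: "0 < a" "a \<le> b" "b \<le> pi"
  shows "(\<Sum>m. c m * sinc_of (b * real m)) \<le> (\<Sum>m. c m * sinc_of (a * real m))"
proof -
  define F where "F x = (\<Sum>m. c m * (x * sinc_of (x * real m)))" for x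
  have der: "(F has_real_derivative cos_series c x) (at x)" for x
    unfolding F_def by (rule has_derivative_sinc_series[OF cos_unimodalD(1)[OF c]])
  have F_eq: "F x = x * (\<Sum>m. c m * sinc_of (x * real m))" for x
  proof -
    have "summable (\<lambda>m. c m * sinc_of (x * real m))"
      by (rule summable_rabs_cancel[OF summable_mult_bounded[OF cos_unimodalD(1)[OF c] abs_sinc_of_le_1]])
    from suminf_mult[OF this, of x] show ?thesis by (simp add: F_def mult_ac)
  qed
  have "a * cos_series c a \<le> F a"
  proof -
    obtain z where "0 < z" "z < a" "F a - F 0 = (a - 0) * cos_series c z"
      using MVT2[of 0 a F "cos_series c"] der ab by auto
    moreover have "cos_series c a \<le> cos_series c z"
      using cos_unimodalD(2)[OF c, of z a] calculation ab by auto
    ultimately show ?thesis using ab by (simp add: F_eq[of 0])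
  qed
  moreover have "F b - F a \<le> (b - a) * cos_series c a"
  proof (cases "a = b")
    case False
    then obtain z where "a < z" "z < b" "F b - F a = (b - a) * cos_series c z"
      using MVT2[of a b F "cos_series c"] der ab by auto
    moreover have "cos_series c z \<le> cos_series c a"
      using cos_unimodalD(2)[OF c, of a z] calculation ab by auto
    ultimately show ?thesis using ab by (simp add: mult_left_mono)
  qed simp
  ultimately have "a * (F b - F a) \<le> (b - a) * F a"
    using ab by (smt (verit) mult_left_mono mult.left_commute)
  hence "a * F b \<le> b * F a" by (simp add: algebra_simps)
  hence "(a * b) * (\<Sum>m. c m * sinc_of (b * real m)) \<le> (a * b) * (\<Sum>m. c m * sinc_of (a * real m))"
    by (simp add: F_eq mult_ac)
  thus ?thesis using ab by simp
qed

text \<open>The new series at \<open>t\<close> is the mean of the old one over \<open>[t - a, t + a]\<close>, so the sign of its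
  derivative is that of the difference of the old values at \<open>t + a\<close> and \<open>t - a\<close>. For
  \<open>t\<close> and \<open>a\<close> in \<open>[0, pi]\<close> the point \<open>t + a\<close> is at least as far from \<open>0\<close> on the circle as
  \<open>t - a\<close>.\<close>

lemma cos_unimodal_mult_sinc:
  assumes c: "cos_unimodal c" and a: "0 < a" "a \<le> pi"
  shows "cos_unimodal (\<lambda>m. c m * sinc_of (a * real m))"
proof -
  note sc = cos_unimodalD(1)[OF c]
  define F where "F x = (\<Sum>m. c m * (x * sinc_of (x * real m)))" for x
  have der: "(F has_real_derivative cos_series c x) (at x)" for x
    unfolding F_def by (rule has_derivative_sinc_series[OF sc])
  let ?d = "\<lambda>m. c m * sinc_of (a * real m)"
  have ser: "cos_series ?d t = (F (t + a) - F (t - a)) / (2 * a)" for t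
  proof -
    have sF: "summable (\<lambda>m. c m * (x * sinc_of (x * real m)))" for x
      by (rule summable_rabs_cancel[OF summable_mult_bounded[OF sc, of _ "\<bar>x\<bar>"]])
         (use abs_sinc_of_le_1 in \<open>auto simp: abs_mult mult_left_le\<close>)
    have *: "?d m * cos (t * real m) =
        (c m * ((t + a) * sinc_of ((t + a) * real m)) - c m * ((t - a) * sinc_of ((t - a) * real m))) / (2 * a)"
      for m
    proof -
      have *: "a * sinc_of (a * real m) * cos (t * real m) =
        ((t + a) * sinc_of ((t + a) * real m) - (t - a) * sinc_of ((t - a) * real m)) / 2"
        unfolding mult_sinc_of_scaled
        by (auto simp: divide_simps sin_add sin_diff ring_distribs)
      have "?d m * cos (t * real m) = c m * (a * sinc_of (a * real m) * cos (t * real m)) / a"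
        using a by simp
      thus ?thesis unfolding * by (simp add: right_diff_distrib)
    qed
    show ?thesis
      unfolding cos_series_def * F_def
      by (subst suminf_diff[OF sF sF]) (intro suminf_divide summable_diff sF)
  qed
  have le: "cos_series c (t + a) \<le> cos_series c (t - a)" if t: "0 \<le> t" "t \<le> pi" for t
  proof -
    have "cos_series c (t - a) = cos_series c \<bar>t - a\<bar>"
      using cos_series_neg[of c "t - a"] by (auto simp: abs_if)
    moreover have "cos_series c (t + a) \<le> cos_series c \<bar>t - a\<bar>"
    proof (cases "t + a \<le> pi")
      case True
      thus ?thesis using t a by (intro cos_unimodalD(2)[OF c]) auto
    next
      case False
      have "cos_series c (2 * pi - (t + a)) \<le> cos_series c \<bar>t - a\<bar>"
        using False t a by (intro cos_unimodalD(2)[OF c]) auto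
      thus ?thesis by (simp only: cos_series_reflect)
    qed
    ultimately show ?thesis by simp
  qed
  have "cos_series ?d t \<le> cos_series ?d s" if st: "0 \<le> s" "s \<le> t" "t \<le> pi" for s t
    unfolding ser
  proof (rule DERIV_nonpos_imp_nonincreasing[OF st(2)])
    fix x assume x: "s \<le> x" "x \<le> t"
    have "((\<lambda>x. (F (x + a) - F (x - a)) / (2 * a)) has_real_derivative
            (cos_series c (x + a) - cos_series c (x - a)) / (2 * a)) (at x)"
      using der[of "x + a"] der[of "x - a"] DERIV_shift[of F _ x a] DERIV_shift[of F _ x "- a"]
      by (intro DERIV_cdivide DERIV_diff) auto
    moreover have "(cos_series c (x + a) - cos_series c (x - a)) / (2 * a) \<le> 0"
      using le[of x] x st a by (simp add: divide_le_0_iff)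
    ultimately show "\<exists>y. ((\<lambda>x. (F (x + a) - F (x - a)) / (2 * a)) has_real_derivative y) (at x) \<and> y \<le> 0"
      by blast
  qed
  moreover have "summable (\<lambda>m. \<bar>?d m\<bar>)"
    by (rule summable_mult_bounded[OF sc abs_sinc_of_le_1])
  ultimately show ?thesis
    by (auto simp: cos_unimodal_def monotone_on_def)
qed

lemma cos_unimodal_mult_prod_sinc:
  assumes "finite J" and "cos_unimodal c" and "\<And>j. j \<in> J \<Longrightarrow> 0 < f j \<and> f j \<le> pi"
  shows "cos_unimodal (\<lambda>m. c m * (\<Prod>j\<in>J. sinc_of (f j * real m)))"
  using assms
proof (induction J rule: finite_induct)
  case (insert j J)
  hence "cos_unimodal (\<lambda>m. c m * (\<Prod>j\<in>J. sinc_of (f j * real m)) * sinc_of (f j * real m))"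
    by (intro cos_unimodal_mult_sinc) auto
  thus ?case using insert by (simp add: mult_ac)
qed simp

text \<open>The induction needs an arbitrary \<open>c\<close>: the factor that is exchanged last has \<open>c\<close> times all
  the other factors in the role of the unimodal sequence.\<close>

lemma suminf_prod_sinc_antimono:
  assumes "finite J" and "cos_unimodal c" and "\<And>j. j \<in> J \<Longrightarrow> 0 < f j \<and> f j \<le> g j \<and> g j \<le> pi"
  shows "(\<Sum>m. c m * (\<Prod>j\<in>J. sinc_of (g j * real m))) \<le> (\<Sum>m. c m * (\<Prod>j\<in>J. sinc_of (f j * real m)))"
  using assms
proof (induction J arbitrary: c rule: finite_induct)
  case (insert j J)
  have fj: "0 < f j" "f j \<le> g j" "g j \<le> pi" using insert.prems by auto
  have uni: "cos_unimodal (\<lambda>m. c m * (\<Prod>j\<in>J. sinc_of (g j * real m)))"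
    using insert.hyps insert.prems by (intro cos_unimodal_mult_prod_sinc) fastforce+
  have "(\<Sum>m. c m * (\<Prod>j\<in>insert j J. sinc_of (g j * real m)))
      = (\<Sum>m. c m * (\<Prod>j\<in>J. sinc_of (g j * real m)) * sinc_of (g j * real m))"
    using insert.hyps by (simp add: mult_ac)
  also have "\<dots> \<le> (\<Sum>m. c m * (\<Prod>j\<in>J. sinc_of (g j * real m)) * sinc_of (f j * real m))"
    by (rule suminf_sinc_antimono[OF uni fj])
  also have "\<dots> = (\<Sum>m. (c m * sinc_of (f j * real m)) * (\<Prod>j\<in>J. sinc_of (g j * real m)))"
    by (simp add: mult_ac)
  also have "\<dots> \<le> (\<Sum>m. (c m * sinc_of (f j * real m)) * (\<Prod>j\<in>J. sinc_of (f j * real m)))"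
    using insert.prems(2) fj order.trans[OF fj(2,3)] by (intro insert.IH cos_unimodal_mult_sinc[OF insert.prems(1)]) auto
  also have "\<dots> = (\<Sum>m. c m * (\<Prod>j\<in>insert j J. sinc_of (f j * real m)))"
    using insert.hyps by (simp add: mult_ac)
  finally show ?case .
qed simp

section \<open>The Poisson kernel\<close>

lemma cos_series_geometric:
  assumes r: "0 \<le> r" "r < 1"
  shows "cos_series (\<lambda>m. r ^ m) t = (1 - r * cos t) / (1 - 2 * r * cos t + r\<^sup>2)"
proof -
  have "(\<lambda>m. (rcis r t) ^ m) sums (1 / (1 - rcis r t))"
    using r by (intro geometric_sums) simp
  from sums_Re[OF this] have "(\<lambda>m. r ^ m * cos (t * real m)) sums Re (1 / (1 - rcis r t))"
    by (simp add: DeMoivre2 mult_ac)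
  moreover have "Re (1 / (1 - rcis r t)) = (1 - r * cos t) / ((1 - r * cos t)\<^sup>2 + (r * sin t)\<^sup>2)"
    by (simp add: Re_divide)
  moreover have "(1 - r * cos t)\<^sup>2 + (r * sin t)\<^sup>2 = 1 - 2 * r * cos t + r\<^sup>2 * ((cos t)\<^sup>2 + (sin t)\<^sup>2)"
    by algebra
  ultimately show ?thesis by (simp add: cos_series_def sums_iff)
qed

lemma cos_unimodal_geometric:
  assumes r: "0 \<le> r" "r < (1::real)"
  shows "cos_unimodal (\<lambda>m. r ^ m)"
proof -
  have "cos_series (\<lambda>m. r ^ m) t \<le> cos_series (\<lambda>m. r ^ m) s"
    if st: "0 \<le> s" "s \<le> t" "t \<le> pi" for s t
  proof -
    have pos: "0 < 1 - 2 * r * cos u + r\<^sup>2" for u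
    proof -
      have "0 < (1 - r)\<^sup>2" using r by simp
      moreover have "r * cos u \<le> r * 1" using r by (intro mult_left_mono) auto
      ultimately show ?thesis by (simp add: power2_eq_square algebra_simps)
    qed
    \<comment> \<open>Cross-multiplied, the difference of the two values of the kernel is
        \<open>r * (cos s - cos t) * (1 - r * r)\<close>.\<close>
    have "cos t \<le> cos s" using st by (intro cos_monotone_0_pi_le) auto
    moreover have "r * r \<le> 1" using r by (simp add: mult_le_one)
    ultimately have "0 \<le> r * (cos s - cos t) * (1 - r * r)"
      using r by simp
    hence "(1 - r * cos t) * (1 - 2 * r * cos s + r\<^sup>2) \<le> (1 - r * cos s) * (1 - 2 * r * cos t + r\<^sup>2)"
      by (simp add: power2_eq_square algebra_simps)
    thus ?thesis
      using pos[of s] pos[of t] by (simp add: cos_series_geometric[OF r] frac_le_eq divide_simps)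
  qed
  moreover have "summable (\<lambda>m. \<bar>r ^ m\<bar>)"
    using r by (simp add: summable_geometric power_abs)
  ultimately show ?thesis by (auto simp: cos_unimodal_def monotone_on_def)
qed

section \<open>Convergence of the series\<close>

lemma suminf_le_by_Abel_means:
  fixes u v :: "nat \<Rightarrow> real"
  assumes u: "summable (\<lambda>m. \<bar>u m\<bar>)" and v: "summable (\<lambda>m. \<bar>v m\<bar>)"
    and le: "\<And>r. 0 \<le> r \<Longrightarrow> r < 1 \<Longrightarrow> (\<Sum>m. r ^ m * u m) \<le> (\<Sum>m. r ^ m * v m)"
  shows "suminf u \<le> suminf v"
proof -
  define r :: "nat \<Rightarrow> real" where "r n = real n / real (Suc n)" for n
  have r: "0 \<le> r n" "r n < 1" for n by (auto simp: r_def)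
  have r_lim: "r \<longlonglongrightarrow> 1" unfolding r_def by (rule LIMSEQ_n_over_Suc_n)
  have lim: "(\<lambda>n. \<Sum>m. r n ^ m * w m) \<longlonglongrightarrow> suminf w" if w: "summable (\<lambda>m. \<bar>w m\<bar>)" for w :: "nat \<Rightarrow> real"
  proof -
    have "eventually (\<lambda>(m, n). norm (r n ^ m * w m) \<le> \<bar>w m\<bar>) (at_top \<times>\<^sub>F at_top)"
    proof (intro always_eventually allI, clarify)
      fix m n
      have "r n ^ m \<le> 1" "0 \<le> r n ^ m" using r[of n] by (auto intro: power_le_one)
      thus "norm (r n ^ m * w m) \<le> \<bar>w m\<bar>"
        by (simp add: abs_mult mult_left_le_one_le)
    qed
    moreover have "(\<lambda>n. r n ^ m * w m) \<longlonglongrightarrow> w m" for m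
      using tendsto_mult[OF tendsto_power[OF r_lim, of m] tendsto_const[of "w m"]] by simp
    ultimately show ?thesis
      using tannerys_theorem[of "\<lambda>m n. r n ^ m * w m" w sequentially "\<lambda>m. \<bar>w m\<bar>"] w by auto
  qed
  show ?thesis
    by (rule LIMSEQ_le[OF lim[OF u] lim[OF v]]) (use le r in auto)
qed

text \<open>Two of the factors already give a bound by a multiple of \<open>1 / m\<^sup>2\<close>.\<close>

lemma summable_prod_sinc:
  assumes "finite J" "i \<in> J" "j \<in> J" "i \<noteq> j" "0 < f i" "0 < f j"
  shows "summable (\<lambda>m. \<bar>\<Prod>k\<in>J. sinc_of (f k * real m)\<bar>)"
proof (rule summable_comparison_test'[where N = 1])
  show "summable (\<lambda>m. 1 / (f i * f j) * inverse (real m ^ 2))"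
    by (intro summable_mult inverse_power_summable) simp
  fix m :: nat assume m: "m \<ge> 1"
  have "(\<Prod>k\<in>J. \<bar>sinc_of (f k * real m)\<bar>)
      = \<bar>sinc_of (f i * real m)\<bar> * (\<bar>sinc_of (f j * real m)\<bar> * (\<Prod>k\<in>J - {i} - {j}. \<bar>sinc_of (f k * real m)\<bar>))"
    using assms by (simp add: prod.remove[of J i] prod.remove[of "J - {i}" j])
  also have "\<dots> \<le> 1 / (f i * real m) * (1 / (f j * real m) * 1)"
    using m assms by (intro mult_mono abs_sinc_of_le prod_le_1) (auto simp: abs_sinc_of_le_1 intro!: prod_nonneg mult_nonneg_nonneg)
  finally show "norm \<bar>\<Prod>k\<in>J. sinc_of (f k * real m)\<bar> \<le> 1 / (f i * f j) * inverse (real m ^ 2)"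
    by (simp add: abs_prod power2_eq_square field_simps)
qed

text \<open>The case of one factor is only conditionally convergent. Multiplied by
  \<open>2 * sin (a / 2)\<close>, the numerator \<open>sin (a * m)\<close> becomes a difference of consecutive bounded terms
  \<open>C\<close>; summation by parts leaves a telescoping series and one with terms of order \<open>1 / m\<^sup>2\<close>.\<close>

lemma summable_sinc:
  assumes "0 < a" "a < 2 * pi"
  shows "summable (\<lambda>m. sinc_of (a * real m))"
proof -
  define C where "C m = cos (a * (real m + 1 / 2))" for m :: nat
  have sin_pos: "sin (a / 2) > 0" using assms by (intro sin_gt_zero) auto
  define u where "u m = C m / real (m + 1)" for m
  have "u \<longlonglongrightarrow> 0"
  proof (rule Lim_null_comparison[where g = "\<lambda>m. 1 / real (m + 1)"])
    show "eventually (\<lambda>m. norm (u m) \<le> 1 / real (m + 1)) sequentially"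
      by (intro always_eventually allI) (simp add: u_def C_def divide_right_mono)
    show "(\<lambda>m. 1 / real (m + 1)) \<longlonglongrightarrow> 0"
      using LIMSEQ_inverse_real_of_nat by (simp add: inverse_eq_divide)
  qed
  hence tel: "summable (\<lambda>m. u m - u (Suc m))" by (rule telescope_summable')
  have abs: "summable (\<lambda>m. C (Suc m) * (1 / real (m + 1) - 1 / real (m + 2)))"
  proof (rule summable_comparison_test'[where N = 0])
    show "summable (\<lambda>m. inverse (real (Suc m) ^ 2))"
      using inverse_power_summable[of 2, where 'a=real] by (subst summable_Suc_iff) simp
    fix m
    have "1 / real (m + 1) - 1 / real (m + 2) = inverse (real (Suc m) * real (m + 2))"
      by (simp add: field_simps)
    also have "\<bar>C (Suc m) * \<dots>\<bar> \<le> 1 * inverse (real (Suc m) ^ 2)"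
      unfolding abs_mult
      by (intro mult_mono) (auto simp: C_def power2_eq_square intro!: le_imp_inverse_le mult_left_mono)
    finally show "norm (C (Suc m) * (1 / real (m + 1) - 1 / real (m + 2))) \<le> inverse (real (Suc m) ^ 2)"
      by simp
  qed
  have eq: "sinc_of (a * real (Suc m)) =
      1 / (2 * a * sin (a / 2)) * ((u m - u (Suc m)) - C (Suc m) * (1 / real (m + 1) - 1 / real (m + 2)))" for m
  proof -
    have "C m - C (Suc m) = 2 * sin (a / 2) * sin (a * real (Suc m))"
    proof -
      have "a * (real m + 1 / 2) = a * real (Suc m) - a / 2" "a * (real (Suc m) + 1 / 2) = a * real (Suc m) + a / 2"
        by (simp_all add: field_simps)
      thus ?thesis unfolding C_def by (simp only: cos_add cos_diff) (simp add: algebra_simps)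
    qed
    moreover have "(u m - u (Suc m)) - C (Suc m) * (1 / real (m + 1) - 1 / real (m + 2)) = (C m - C (Suc m)) / real (Suc m)"
    proof -
      have "x / p - y / q - y * (1 / p - 1 / q) = (x - y) / p" for x y p q :: real
        by (simp add: diff_divide_distrib right_diff_distrib)
      from this[of "C m" "real (m + 1)" "C (Suc m)" "real (m + 2)"] show ?thesis by (simp add: u_def)
    qed
    ultimately have diff_eq: "(u m - u (Suc m)) - C (Suc m) * (1 / real (m + 1) - 1 / real (m + 2))
        = 2 * sin (a / 2) * sin (a * real (Suc m)) / real (Suc m)"
      by (simp only:)
    show ?thesis
      unfolding diff_eq sinc_of_def using sin_pos assms by (simp del: of_nat_Suc)
  qed
  have "summable (\<lambda>m. sinc_of (a * real (Suc m)))"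
    unfolding eq by (intro summable_mult summable_diff tel abs)
  thus ?thesis by (subst (asm) summable_Suc_iff)
qed

section \<open>The comparison of the sums\<close>

theorem mainTheorem2:
  fixes n :: nat and a :: "nat \<Rightarrow> real"
  assumes "\<And>k. 1 \<le> k \<Longrightarrow> k \<le> n \<Longrightarrow> a 0 \<ge> a k \<and> a k > 0"
    and "a 0 > 0"
    and "real (n + 1) * a 0 < 2 * pi"
  shows "summable (\<lambda>m::nat. \<Prod>k=0..n. sinc (a k * real m))
       \<and> summable (\<lambda>m::nat. sinc (a 0 * real m) ^ (n + 1))
       \<and> (\<Sum>m::nat. \<Prod>k=0..n. sinc (a k * real m)) \<ge> (\<Sum>m::nat. sinc (a 0 * real m) ^ (n + 1))"
  unfolding sinc_of_def[symmetric]
proof (cases "n = 0")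
  case True
  have "summable (\<lambda>m. sinc_of (a 0 * real m))"
    using assms True by (intro summable_sinc) auto
  with True show "summable (\<lambda>m::nat. \<Prod>k=0..n. sinc_of (a k * real m))
       \<and> summable (\<lambda>m::nat. sinc_of (a 0 * real m) ^ (n + 1))
       \<and> (\<Sum>m::nat. \<Prod>k=0..n. sinc_of (a k * real m)) \<ge> (\<Sum>m::nat. sinc_of (a 0 * real m) ^ (n + 1))"
    by simp
next
  case False
  have pos: "0 < a k" "a k \<le> a 0" if "k \<le> n" for k
    using assms(1)[of k] assms(2) that by (cases "k = 0"; simp)+
  have "2 * a 0 \<le> real (n + 1) * a 0"
    using False assms(2) by (intro mult_right_mono) auto
  hence le_pi: "a 0 \<le> pi" using assms(3) by simp
  have pow: "sinc_of (a 0 * real m) ^ (n + 1) = (\<Prod>k=0..n. sinc_of (a 0 * real m))" for m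
    by simp
  have sum1: "summable (\<lambda>m. \<bar>\<Prod>k=0..n. sinc_of (a k * real m)\<bar>)"
    using False pos by (intro summable_prod_sinc[of _ 0 1]) auto
  have sum2: "summable (\<lambda>m. \<bar>\<Prod>k=0..n. sinc_of (a 0 * real m)\<bar>)"
    using False pos by (intro summable_prod_sinc[of _ 0 1 "\<lambda>_. a 0"]) auto
  have "(\<Sum>m. \<Prod>k=0..n. sinc_of (a 0 * real m)) \<le> (\<Sum>m. \<Prod>k=0..n. sinc_of (a k * real m))"
  proof (rule suminf_le_by_Abel_means[OF sum2 sum1])
    fix r :: real assume "0 \<le> r" "r < 1"
    thus "(\<Sum>m. r ^ m * (\<Prod>k=0..n. sinc_of (a 0 * real m))) \<le> (\<Sum>m. r ^ m * (\<Prod>k=0..n. sinc_of (a k * real m)))"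
      using pos le_pi by (intro suminf_prod_sinc_antimono cos_unimodal_geometric) auto
  qed
  with sum1 sum2 show "summable (\<lambda>m::nat. \<Prod>k=0..n. sinc_of (a k * real m))
       \<and> summable (\<lambda>m::nat. sinc_of (a 0 * real m) ^ (n + 1))
       \<and> (\<Sum>m::nat. \<Prod>k=0..n. sinc_of (a k * real m)) \<ge> (\<Sum>m::nat. sinc_of (a 0 * real m) ^ (n + 1))"
    unfolding pow by (auto intro: summable_rabs_cancel)
qed

end
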